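(* Let $\alpha\in\mathbb{R}$, $d\in\mathbb{N}$, let $\{f_n\}_{n=1}^\infty$ be a sequence in $D_\alpha\setminus\{0\}$ and let $f\in D_\alpha\setminus\{0\}$. Let $p_d$ be the $d$-th optimal polynomial approximant to $1/f$ and $p_{d,n}$ the $d$-th optimal polynomial approximant to $1/f_n$, and let $Mc=b$ and $M_nc_n=b_n$ be the corresponding linear systems associated to $f$ and to $f_n$, respectively. If $\{f_n\}_{n=1}^\infty$ converges to $f$ in the norm of $D_\alpha$, then $$\lim_{n\to\infty}\|b_n-b\|_0=\lim_{n\to\infty}\|M_n-M\|_F=\lim_{n\to\infty}\|p_{d,n}-p_d\|_\alpha=0,$$ with a rate of decay in all cases of the form $C(d,\alpha,f)\|f_n-f\|_\alpha$; that is, there is a constant $C(d,\alpha,f)$, depending only on $d$, $\alpha$ and $f$, such that each of $\|b_n-b\|_0$, $\|M_n-M\|_F$ and $\|p_{d,n}-p_d\|_\alpha$ is at most $C(d,\alpha,f)\|f_n-f\|_\alpha$ for all sufficiently large $n$.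
   Context: $\mathbb{D}$ is the open unit disc in $\mathbb{C}$. For $\alpha\in\mathbb{R}$, the Dirichlet-type space $D_\alpha$ is the Hilbert space of all analytic functions $f(z)=\sum_{k=0}^\infty a_kz^k$ on $\mathbb{D}$ with $\|f\|_\alpha^2:=\sum_{k=0}^\infty |a_k|^2(k+1)^\alpha<\infty$, with inner product $\langle f,g\rangle_\alpha=\sum_{k=0}^\infty a_k\overline{b_k}(k+1)^\alpha$ for $g(z)=\sum_{k=0}^\infty b_kz^k$. $S$ is the shift operator, $Sf(z)=zf(z)$. Let $\mathcal{P}_d$ be the space of polynomials of degree at most $d$. For $f\in D_\alpha\setminus\{0\}$, the $d$-th optimal polynomial approximant (o.p.a.) to $1/f$ is the unique polynomial $p_d\in\mathcal{P}_d$ minimizing $\|pf-1\|_\alpha$ over $p\in\mathcal{P}_d$ (equivalently, $p_df$ is the orthogonal projection of $1$ onto $f\mathcal{P}_d$). The linear system associated to $f$ (and $d$) is $Mc=b$, where $M=(m_{j,k})_{j,k=0}^d\in\mathbb{C}^{(d+1)\times(d+1)}$ has entries $m_{j,k}=\langle S^kf,S^jf\rangle_\alpha$ and $b=(b_k)_{k=0}^d\in\mathbb{C}^{d+1}$ has entries $b_k=\langle 1,S^kf\rangle_\alpha$. The matrix $M$ is invertible, and the unique solution $c=(c_0,\dots,c_d)$ is the vector of coefficients of $p_d(z)=\sum_{k=0}^dc_kz^k$. $\|\cdot\|_F$ is the Frobenius norm of matrices. For vectors in $\mathbb{C}^{d+1}$ (identified with polynomials in $\mathcal{P}_d$ via coefficients),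 $\|\cdot\|_0$ is the Euclidean norm. *)

theory Defs
  imports
    "HOL-Complex_Analysis.Complex_Analysis"
    "Jordan_Normal_Form.Matrix"
begin

text \<open>
  Elements of the Dirichlet-type space are represented by total functions on the complex plane;
  only their values on the open unit disc matter.  In particular, the zero element is represented
  by every function that vanishes on the disc.
\<close>

definition taylor_coeff :: "(complex \<Rightarrow> complex) \<Rightarrow> nat \<Rightarrow> complex" where
  "taylor_coeff f k = (deriv ^^ k) f 0 / fact k"

definition dirichlet_space :: "real \<Rightarrow> (complex \<Rightarrow> complex) set" where
  "dirichlet_space \<alpha> =
     {f. f holomorphic_on ball 0 1 \<and>
         summable (\<lambda>k. (cmod (taylor_coeff f k))\<^sup>2 * (real k + 1) powr \<alpha>)}"

definition dirichlet_nonzero :: "real \<Rightarrow> (complex \<Rightarrow> complex) set" where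
  "dirichlet_nonzero \<alpha> = {f \<in> dirichlet_space \<alpha>. \<exists>z\<in>ball 0 1. f z \<noteq> 0}"

definition dirichlet_norm :: "real \<Rightarrow> (complex \<Rightarrow> complex) \<Rightarrow> real" where
  "dirichlet_norm \<alpha> f = sqrt (\<Sum>k. (cmod (taylor_coeff f k))\<^sup>2 * (real k + 1) powr \<alpha>)"

definition dirichlet_inner ::
    "real \<Rightarrow> (complex \<Rightarrow> complex) \<Rightarrow> (complex \<Rightarrow> complex) \<Rightarrow> complex" where
  "dirichlet_inner \<alpha> f g =
     (\<Sum>k. taylor_coeff f k * cnj (taylor_coeff g k) * of_real ((real k + 1) powr \<alpha>))"

definition shift :: "(complex \<Rightarrow> complex) \<Rightarrow> complex \<Rightarrow> complex" where
  "shift f = (\<lambda>z. z * f z)"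

definition is_opa :: "real \<Rightarrow> nat \<Rightarrow> (complex \<Rightarrow> complex) \<Rightarrow> complex poly \<Rightarrow> bool" where
  "is_opa \<alpha> d f p \<longleftrightarrow>
     degree p \<le> d \<and>
     (\<forall>q. degree q \<le> d \<longrightarrow>
        dirichlet_norm \<alpha> (\<lambda>z. poly p z * f z - 1) \<le> dirichlet_norm \<alpha> (\<lambda>z. poly q z * f z - 1))"

text \<open>
  The minimizer exists and is unique for every nonzero element of the space, so the description
  below is proper on \<^term>\<open>dirichlet_nonzero \<alpha>\<close>.
\<close>

definition opa :: "real \<Rightarrow> nat \<Rightarrow> (complex \<Rightarrow> complex) \<Rightarrow> complex poly" where
  "opa \<alpha> d f = (THE p. is_opa \<alpha> d f p)"

definition system_mat :: "real \<Rightarrow> nat \<Rightarrow> (complex \<Rightarrow> complex) \<Rightarrow> complex mat" where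
  "system_mat \<alpha> d f =
     mat (d + 1) (d + 1) (\<lambda>(j, k). dirichlet_inner \<alpha> ((shift ^^ k) f) ((shift ^^ j) f))"

definition system_rhs :: "real \<Rightarrow> nat \<Rightarrow> (complex \<Rightarrow> complex) \<Rightarrow> complex vec" where
  "system_rhs \<alpha> d f = vec (d + 1) (\<lambda>k. dirichlet_inner \<alpha> (\<lambda>_. 1) ((shift ^^ k) f))"

definition frobenius_norm :: "complex mat \<Rightarrow> real" where
  "frobenius_norm A =
     sqrt (\<Sum>i<dim_row A. \<Sum>j<dim_col A. (cmod (index_mat A (i, j)))\<^sup>2)"

definition euclidean_norm :: "complex vec \<Rightarrow> real" where
  "euclidean_norm v = sqrt (\<Sum>i<dim_vec v. (cmod (vec_index v i))\<^sup>2)"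

end

theory Submission
  imports Defs
begin

text \<open>
  Write r and p for the optimal approximants of g and f, q for r - p and D for g - f. Since p f - 1
  and r g - 1 are orthogonal to the polynomial multiples of f and of g, the square of the norm of
  q g equals -<p f - 1, q D> - <p D, q g>, which is at most a constant times |q| |D| plus a constant
  times |D| |q g|. As q ranges over a finite-dimensional space, the norm of q f, hence that of q g
  when D is small, dominates the size of q; dividing by the norm of q g gives |q| <= C |D|.
  This avoids inverting the matrix M. All norms are computed on Taylor expansions.
\<close>

section \<open>Weighted square-summable power series\<close>

text \<open>The two orthogonality relations refer to different subspaces, the polynomial multiples
  of f and those of g. Testing both with the same polynomial q makes them comparable, because q g
  and q f differ only by q D, which is of the order of D. The constant and the radius of smallness
  have to be fixed from f, d and \<alpha> before g is named; this is what gives one constant for all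
  sequences. Norm and inner product see a function only through its Taylor coefficients at 0. After
  passing to formal power series, products are Cauchy products and the shift is multiplication by
  \<open>fps_X\<close>; analyticity returns only when functions are translated into series. The
  weight must be handled for both signs of \<alpha>, and the bounded ratio of consecutive weights is
  what makes the shift bounded.\<close>

locale dirichlet_weight =
  fixes \<alpha> :: real
begin

definition dirichlet_fps :: "complex fps \<Rightarrow> bool" where
  "dirichlet_fps F \<longleftrightarrow> summable (\<lambda>k. (cmod (fps_nth F k))\<^sup>2 * (real k + 1) powr \<alpha>)"

definition fps_norm :: "complex fps \<Rightarrow> real" where
  "fps_norm F = sqrt (\<Sum>k. (cmod (fps_nth F k))\<^sup>2 * (real k + 1) powr \<alpha>)"

definition fps_inner :: "complex fps \<Rightarrow> complex fps \<Rightarrow> complex" where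
  "fps_inner F G =
     (\<Sum>k. fps_nth F k * cnj (fps_nth G k) * of_real ((real k + 1) powr \<alpha>))"

lemma dirichlet_fps_scale: "dirichlet_fps F \<Longrightarrow> dirichlet_fps (fps_const c * F)"
  unfolding dirichlet_fps_def
  by (simp add: norm_mult power_mult_distrib mult.assoc summable_mult)

lemma dirichlet_fps_add:
  assumes "dirichlet_fps F" "dirichlet_fps G"
  shows "dirichlet_fps (F + G)"
  unfolding dirichlet_fps_def
proof (rule summable_comparison_test')
  show "summable (\<lambda>k. 2 * ((cmod (fps_nth F k))\<^sup>2 * (real k + 1) powr \<alpha> +
                           (cmod (fps_nth G k))\<^sup>2 * (real k + 1) powr \<alpha>))"
    using assms unfolding dirichlet_fps_def by (intro summable_mult summable_add)
next
  fix k :: nat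
  have "(cmod (fps_nth F k + fps_nth G k))\<^sup>2 \<le> (cmod (fps_nth F k) + cmod (fps_nth G k))\<^sup>2"
    by (intro power_mono norm_triangle_ineq) auto
  also have "\<dots> \<le> 2 * ((cmod (fps_nth F k))\<^sup>2 + (cmod (fps_nth G k))\<^sup>2)"
    using sum_squares_bound[of "cmod (fps_nth F k)" "cmod (fps_nth G k)"]
    by (simp add: power2_sum)
  finally have "(cmod (fps_nth F k + fps_nth G k))\<^sup>2 * (real k + 1) powr \<alpha>
      \<le> 2 * ((cmod (fps_nth F k))\<^sup>2 + (cmod (fps_nth G k))\<^sup>2) * (real k + 1) powr \<alpha>"
    by (rule mult_right_mono) simp
  then show "norm ((cmod (fps_nth (F + G) k))\<^sup>2 * (real k + 1) powr \<alpha>)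
      \<le> 2 * ((cmod (fps_nth F k))\<^sup>2 * (real k + 1) powr \<alpha> +
             (cmod (fps_nth G k))\<^sup>2 * (real k + 1) powr \<alpha>)"
    by (simp add: algebra_simps)
qed

lemma dirichlet_fps_diff:
  assumes "dirichlet_fps F" "dirichlet_fps G"
  shows "dirichlet_fps (F - G)"
proof -
  have "F - G = F + fps_const (-1) * G" by (simp add: fps_eq_iff)
  then show ?thesis using assms by (simp only: dirichlet_fps_add dirichlet_fps_scale)
qed

lemma dirichlet_fps_const [simp]: "dirichlet_fps (fps_const c)"
  unfolding dirichlet_fps_def by (rule summable_finite[of "{0}"]) auto

lemma dirichlet_fps_0 [simp]: "dirichlet_fps 0"
  and dirichlet_fps_1 [simp]: "dirichlet_fps 1"
  using dirichlet_fps_const[of 0] dirichlet_fps_const[of 1] by simp_all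

lemma dirichlet_fps_sum: "(\<And>i. i \<in> I \<Longrightarrow> dirichlet_fps (F i)) \<Longrightarrow> dirichlet_fps (\<Sum>i\<in>I. F i)"
  by (induction I rule: infinite_finite_induct) (auto intro: dirichlet_fps_add)

text \<open>The ratio (k+2)/(k+1) lies between 1 and 2. A base of at least 1 allows the exponent to
  be raised to its absolute value, which treats increasing and decreasing weights alike; the base is
  then raised to 2.\<close>

lemma weight_Suc: "(real k + 2) powr \<alpha> \<le> 2 powr \<bar>\<alpha>\<bar> * (real k + 1) powr \<alpha>"
proof -
  have "(real k + 2) powr \<alpha> = ((real k + 2) / (real k + 1)) powr \<alpha> * (real k + 1) powr \<alpha>"
    by (simp add: powr_divide)
  also have "((real k + 2) / (real k + 1)) powr \<alpha> \<le> ((real k + 2) / (real k + 1)) powr \<bar>\<alpha>\<bar>"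
    by (rule powr_mono) (auto simp: field_simps)
  also have "\<dots> \<le> 2 powr \<bar>\<alpha>\<bar>"
    by (rule powr_mono2) (auto simp: field_simps)
  finally show ?thesis by (simp add: mult_right_mono)
qed

text \<open>An upper bound for the operator norm of the shift; the square root appears because the
  weight enters the squared norm.\<close>

definition shift_const :: real where "shift_const = sqrt (2 powr \<bar>\<alpha>\<bar>)"

lemma shift_const_ge_1: "shift_const \<ge> 1"
  unfolding shift_const_def using ge_one_powr_ge_zero[of 2 "\<bar>\<alpha>\<bar>"] by simp

lemma dirichlet_fps_X:
  assumes "dirichlet_fps F"
  shows "dirichlet_fps (fps_X * F)" and "fps_norm (fps_X * F) \<le> shift_const * fps_norm F"
proof -
  define a where "a k = (cmod (fps_nth F k))\<^sup>2 * (real k + 1) powr \<alpha>" for k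
  define b where "b k = (cmod (fps_nth (fps_X * F) k))\<^sup>2 * (real k + 1) powr \<alpha>" for k
  have sa: "summable a" using assms unfolding dirichlet_fps_def a_def .
  have b_Suc: "b (Suc k) \<le> 2 powr \<bar>\<alpha>\<bar> * a k" for k
    using mult_left_mono[OF weight_Suc[of k], of "(cmod (fps_nth F k))\<^sup>2"]
    by (simp add: a_def b_def fps_X_mult_nth algebra_simps)
  have b_nonneg: "b k \<ge> 0" for k by (simp add: b_def)
  have sb': "summable (\<lambda>k. b (Suc k))"
    by (rule summable_comparison_test'[OF summable_mult[OF sa, of "2 powr \<bar>\<alpha>\<bar>"]])
      (use b_Suc b_nonneg in auto)
  then have sb: "summable b" by (simp add: summable_Suc_iff)
  then show "dirichlet_fps (fps_X * F)" unfolding dirichlet_fps_def b_def .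
  \<comment> \<open>The head term drops out since \<open>fps_X * F\<close> has constant coefficient
    0.\<close>
  have "suminf b = (\<Sum>k. b (Suc k))"
    using suminf_split_head[OF sb] by (simp add: b_def)
  also have "\<dots> \<le> (\<Sum>k. 2 powr \<bar>\<alpha>\<bar> * a k)"
    by (intro suminf_le b_Suc sb' summable_mult sa)
  also have "\<dots> = 2 powr \<bar>\<alpha>\<bar> * suminf a" by (rule suminf_mult[OF sa])
  finally have "sqrt (suminf b) \<le> sqrt (2 powr \<bar>\<alpha>\<bar> * suminf a)" by simp
  then show "fps_norm (fps_X * F) \<le> shift_const * fps_norm F"
    by (simp add: fps_norm_def shift_const_def real_sqrt_mult a_def [abs_def] b_def [abs_def])
qed

lemma dirichlet_fps_X_power: "dirichlet_fps F \<Longrightarrow> dirichlet_fps (fps_X ^ j * F)"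
  by (induction j) (auto simp: mult.assoc dirichlet_fps_X)

lemma fps_norm_X_power_le:
  "dirichlet_fps F \<Longrightarrow> fps_norm (fps_X ^ j * F) \<le> shift_const ^ j * fps_norm F"
proof (induction j)
  case (Suc j)
  have "fps_norm (fps_X * (fps_X ^ j * F)) \<le> shift_const * fps_norm (fps_X ^ j * F)"
    by (intro dirichlet_fps_X dirichlet_fps_X_power Suc)
  also have "\<dots> \<le> shift_const * (shift_const ^ j * fps_norm F)"
    using Suc shift_const_ge_1 by (intro mult_left_mono) auto
  finally show ?case by (simp add: mult.assoc)
qed simp

section \<open>Polynomial multiples as linear combinations of shifts\<close>

lemma fps_of_poly_eq_sum:
  fixes q :: "complex poly"
  assumes "degree q \<le> d"
  shows "fps_of_poly q = (\<Sum>j\<le>d. fps_const (coeff q j) * fps_X ^ j)"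
proof -
  have "q = (\<Sum>j\<le>d. monom (coeff q j) j)"
    using assms by (simp add: poly_as_sum_of_monoms')
  then have "fps_of_poly q = fps_of_poly (\<Sum>j\<le>d. monom (coeff q j) j)" by simp
  then show ?thesis by (simp add: fps_of_poly_sum fps_of_poly_monom)
qed

lemma fps_of_poly_mult_eq_sum:
  fixes q :: "complex poly"
  assumes "degree q \<le> d"
  shows "fps_of_poly q * F = (\<Sum>j\<le>d. fps_const (coeff q j) * (fps_X ^ j * F))"
  unfolding fps_of_poly_eq_sum[OF assms] by (simp add: sum_distrib_right mult.assoc)

lemma dirichlet_fps_poly_mult:
  assumes "dirichlet_fps F"
  shows "dirichlet_fps (fps_of_poly q * F)"
  unfolding fps_of_poly_mult_eq_sum[OF order_refl]
  by (intro dirichlet_fps_sum dirichlet_fps_scale dirichlet_fps_X_power assms)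

section \<open>The weighted inner product, its norm and the Cauchy-Schwarz inequality\<close>

lemma dirichlet_fps_imp_inner_summable:
  assumes "dirichlet_fps F" "dirichlet_fps G"
  shows "summable (\<lambda>k. cmod (fps_nth F k * cnj (fps_nth G k) * of_real ((real k + 1) powr \<alpha>)))"
    and "summable (\<lambda>k. fps_nth F k * cnj (fps_nth G k) * of_real ((real k + 1) powr \<alpha>))"
proof -
  show "summable (\<lambda>k. cmod (fps_nth F k * cnj (fps_nth G k) * of_real ((real k + 1) powr \<alpha>)))"
  proof (rule summable_comparison_test')
    show "summable (\<lambda>k. (cmod (fps_nth F k))\<^sup>2 * (real k + 1) powr \<alpha> +
                         (cmod (fps_nth G k))\<^sup>2 * (real k + 1) powr \<alpha>)"
      using assms unfolding dirichlet_fps_def by (intro summable_add)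
  next
    fix k :: nat
    have "cmod (fps_nth F k) * cmod (fps_nth G k)
        \<le> (cmod (fps_nth F k))\<^sup>2 + (cmod (fps_nth G k))\<^sup>2"
      using sum_squares_bound[of "cmod (fps_nth F k)" "cmod (fps_nth G k)"]
        mult_nonneg_nonneg[of "cmod (fps_nth F k)" "cmod (fps_nth G k)"]
        norm_ge_zero[of "fps_nth F k"] norm_ge_zero[of "fps_nth G k"]
      by linarith
    then show "norm (cmod (fps_nth F k * cnj (fps_nth G k) * of_real ((real k + 1) powr \<alpha>)))
        \<le> (cmod (fps_nth F k))\<^sup>2 * (real k + 1) powr \<alpha> +
           (cmod (fps_nth G k))\<^sup>2 * (real k + 1) powr \<alpha>"
      by (simp add: norm_mult mult_right_mono flip: distrib_right)
  qed
  then show "summable (\<lambda>k. fps_nth F k * cnj (fps_nth G k) * of_real ((real k + 1) powr \<alpha>))"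
    by (rule summable_norm_cancel)
qed

lemma fps_inner_add_left:
  assumes "dirichlet_fps F" "dirichlet_fps G" "dirichlet_fps H"
  shows "fps_inner (F + G) H = fps_inner F H + fps_inner G H"
  unfolding fps_inner_def
  using suminf_add[OF dirichlet_fps_imp_inner_summable(2)[OF assms(1,3)]
      dirichlet_fps_imp_inner_summable(2)[OF assms(2,3)]]
  by (simp add: algebra_simps)

lemma fps_inner_scale_left:
  assumes "dirichlet_fps F" "dirichlet_fps G"
  shows "fps_inner (fps_const c * F) G = c * fps_inner F G"
  unfolding fps_inner_def
  using suminf_mult[OF dirichlet_fps_imp_inner_summable(2)[OF assms], of c]
  by (simp add: algebra_simps)

lemma fps_inner_commute:
  assumes "dirichlet_fps F" "dirichlet_fps G"
  shows "fps_inner F G = cnj (fps_inner G F)"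
proof -
  have "(\<lambda>k. cnj (fps_nth G k * cnj (fps_nth F k) * of_real ((real k + 1) powr \<alpha>)))
          sums cnj (fps_inner G F)"
    unfolding fps_inner_def sums_cnj
    by (intro summable_sums dirichlet_fps_imp_inner_summable assms)
  then show ?thesis unfolding fps_inner_def by (simp add: sums_iff mult_ac)
qed

lemma fps_inner_diff_left:
  assumes "dirichlet_fps F" "dirichlet_fps G" "dirichlet_fps H"
  shows "fps_inner (F - G) H = fps_inner F H - fps_inner G H"
proof -
  have "F - G = F + fps_const (-1) * G" by (simp add: fps_eq_iff)
  then show ?thesis
    using assms by (simp only: fps_inner_add_left fps_inner_scale_left dirichlet_fps_scale) simp
qed

lemma fps_inner_0_right [simp]: "fps_inner F 0 = 0"
  by (simp add: fps_inner_def)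

lemma fps_inner_add_right:
  assumes "dirichlet_fps F" "dirichlet_fps G" "dirichlet_fps H"
  shows "fps_inner H (F + G) = fps_inner H F + fps_inner H G"
  using fps_inner_add_left[OF assms] fps_inner_commute[OF assms(3) dirichlet_fps_add[OF assms(1,2)]]
    fps_inner_commute[OF assms(3,1)] fps_inner_commute[OF assms(3,2)] by simp

lemma fps_inner_diff_right:
  assumes "dirichlet_fps F" "dirichlet_fps G" "dirichlet_fps H"
  shows "fps_inner H (F - G) = fps_inner H F - fps_inner H G"
  using fps_inner_diff_left[OF assms] fps_inner_commute[OF assms(3) dirichlet_fps_diff[OF assms(1,2)]]
    fps_inner_commute[OF assms(3,1)] fps_inner_commute[OF assms(3,2)] by simp

lemma fps_inner_scale_right:
  assumes "dirichlet_fps F" "dirichlet_fps G"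
  shows "fps_inner F (fps_const c * G) = cnj c * fps_inner F G"
  using fps_inner_scale_left[OF assms(2,1), of c] fps_inner_commute[OF assms]
    fps_inner_commute[OF assms(1) dirichlet_fps_scale[OF assms(2), of c]] by simp

lemma fps_norm_nonneg: "dirichlet_fps F \<Longrightarrow> fps_norm F \<ge> 0"
  unfolding fps_norm_def dirichlet_fps_def by (intro real_sqrt_ge_zero suminf_nonneg) auto

lemma fps_norm_1 [simp]: "fps_norm 1 = 1"
  using suminf_finite[of "{0}" "\<lambda>k. (cmod (fps_nth (1 :: complex fps) k))\<^sup>2 * (real k + 1) powr \<alpha>"]
  by (simp add: fps_norm_def)

lemma fps_norm_power2:
  assumes "dirichlet_fps F"
  shows "(fps_norm F)\<^sup>2 = (\<Sum>k. (cmod (fps_nth F k))\<^sup>2 * (real k + 1) powr \<alpha>)"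
  unfolding fps_norm_def using assms
  by (intro real_sqrt_pow2 suminf_nonneg) (auto simp: dirichlet_fps_def)

lemma fps_inner_self:
  assumes "dirichlet_fps F"
  shows "fps_inner F F = of_real ((fps_norm F)\<^sup>2)"
proof -
  have "fps_nth F k * cnj (fps_nth F k) * of_real ((real k + 1) powr \<alpha>)
      = of_real ((cmod (fps_nth F k))\<^sup>2 * (real k + 1) powr \<alpha>)" for k
    by (simp only: of_real_mult complex_norm_square)
  then show ?thesis
    using assms unfolding fps_inner_def fps_norm_power2[OF assms] dirichlet_fps_def
    by (simp only: suminf_of_real)
qed

text \<open>A single term of the nonnegative series is at most its sum. This continuity of the
  coefficient functionals gives definiteness of the norm, and later it recovers the coefficients of
  q from the norm of q F.\<close>

lemma fps_nth_le_fps_norm: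
  assumes "dirichlet_fps F"
  shows "cmod (fps_nth F k) \<le> (real k + 1) powr (- \<alpha> / 2) * fps_norm F"
proof -
  have "(\<Sum>i\<in>{k}. (cmod (fps_nth F i))\<^sup>2 * (real i + 1) powr \<alpha>) \<le> (fps_norm F)\<^sup>2"
    unfolding fps_norm_power2[OF assms]
    using assms by (intro sum_le_suminf) (auto simp: dirichlet_fps_def)
  then have "((real k + 1) powr (\<alpha> / 2) * cmod (fps_nth F k))\<^sup>2 \<le> (fps_norm F)\<^sup>2"
    by (simp add: power_mult_distrib mult.commute flip: powr_power)
      (simp add: power2_eq_square mult.commute flip: powr_add)
  then have "(real k + 1) powr (\<alpha> / 2) * cmod (fps_nth F k) \<le> fps_norm F"
    by (rule power2_le_imp_le) (rule fps_norm_nonneg[OF assms])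
  then show ?thesis
    by (simp add: powr_minus field_simps)
qed

lemma fps_norm_eq_0_imp:
  assumes "dirichlet_fps F" "fps_norm F = 0"
  shows "F = 0"
  using fps_nth_le_fps_norm[OF assms(1)] assms(2) by (simp add: fps_eq_iff)

text \<open>Each weight is split into two square roots, one for either factor. The finite inequality
  then bounds all partial sums of the moduli uniformly, and absolute summability passes the bound to
  the full series.\<close>

lemma fps_inner_Cauchy_Schwarz:
  assumes F: "dirichlet_fps F" and G: "dirichlet_fps G"
  shows "cmod (fps_inner F G) \<le> fps_norm F * fps_norm G"
proof -
  let ?w = "\<lambda>k. (real k + 1) powr \<alpha>"
  let ?a = "\<lambda>k. cmod (fps_nth F k) * sqrt (?w k)"
  let ?b = "\<lambda>k. cmod (fps_nth G k) * sqrt (?w k)"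
  let ?t = "\<lambda>k. fps_nth F k * cnj (fps_nth G k) * of_real (?w k)"
  have partial: "(\<Sum>k<n. cmod (?t k)) \<le> fps_norm F * fps_norm G" for n
  proof (rule power2_le_imp_le)
    have eq: "cmod (?t k) = ?a k * ?b k" for k
    proof -
      have "?w k = sqrt (?w k) * sqrt (?w k)" by simp
      then show ?thesis by (simp add: norm_mult del: real_sqrt_mult_self)
    qed
    have "(\<Sum>k<n. cmod (?t k))\<^sup>2 \<le> (\<Sum>k<n. (?a k)\<^sup>2) * (\<Sum>k<n. (?b k)\<^sup>2)"
      unfolding eq by (rule Cauchy_Schwarz_ineq_sum)
    also have "\<dots> \<le> (fps_norm F)\<^sup>2 * (fps_norm G)\<^sup>2"
    proof (rule mult_mono)
      show "(\<Sum>k<n. (?a k)\<^sup>2) \<le> (fps_norm F)\<^sup>2" "(\<Sum>k<n. (?b k)\<^sup>2) \<le> (fps_norm G)\<^sup>2"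
        unfolding fps_norm_power2[OF F] fps_norm_power2[OF G] power_mult_distrib
        using F G by (auto simp: dirichlet_fps_def intro!: sum_le_suminf)
    qed (auto intro: sum_nonneg)
    finally show "(\<Sum>k<n. cmod (?t k))\<^sup>2 \<le> (fps_norm F * fps_norm G)\<^sup>2"
      by (simp add: power_mult_distrib)
  qed (simp add: fps_norm_nonneg F G)
  have "cmod (fps_inner F G) \<le> (\<Sum>k. cmod (?t k))"
    unfolding fps_inner_def by (rule summable_norm[OF dirichlet_fps_imp_inner_summable(1)[OF F G]])
  also have "\<dots> \<le> fps_norm F * fps_norm G"
    by (rule suminf_le_const[OF dirichlet_fps_imp_inner_summable(1)[OF F G] partial])
  finally show ?thesis .
qed

lemma fps_norm_add_power2:
  assumes "dirichlet_fps F" "dirichlet_fps G"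
  shows "(fps_norm (F + G))\<^sup>2 = (fps_norm F)\<^sup>2 + (fps_norm G)\<^sup>2 + 2 * Re (fps_inner F G)"
proof -
  have "fps_inner (F + G) (F + G) =
      fps_inner F F + fps_inner G G + fps_inner F G + cnj (fps_inner F G)"
    using assms
    by (simp add: fps_inner_add_left fps_inner_add_right dirichlet_fps_add fps_inner_commute[of G F])
  then have "of_real ((fps_norm (F + G))\<^sup>2) =
      of_real ((fps_norm F)\<^sup>2) + of_real ((fps_norm G)\<^sup>2) + fps_inner F G + cnj (fps_inner F G)"
    using assms by (simp only: fps_inner_self dirichlet_fps_add)
  from arg_cong[OF this, of Re] show ?thesis by simp
qed

lemma fps_norm_triangle:
  assumes "dirichlet_fps F" "dirichlet_fps G"
  shows "fps_norm (F + G) \<le> fps_norm F + fps_norm G"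
proof (rule power2_le_imp_le)
  have "Re (fps_inner F G) \<le> fps_norm F * fps_norm G"
    using complex_Re_le_cmod fps_inner_Cauchy_Schwarz[OF assms] by (rule order_trans)
  then show "(fps_norm (F + G))\<^sup>2 \<le> (fps_norm F + fps_norm G)\<^sup>2"
    by (simp add: fps_norm_add_power2[OF assms] power2_sum)
qed (simp add: assms fps_norm_nonneg)

lemma fps_norm_scale:
  assumes "dirichlet_fps F"
  shows "fps_norm (fps_const c * F) = cmod c * fps_norm F"
proof -
  have "(\<Sum>k. (cmod (fps_nth (fps_const c * F) k))\<^sup>2 * (real k + 1) powr \<alpha>)
      = (cmod c)\<^sup>2 * (\<Sum>k. (cmod (fps_nth F k))\<^sup>2 * (real k + 1) powr \<alpha>)"
    using suminf_mult[OF assms[unfolded dirichlet_fps_def], of "(cmod c)\<^sup>2"]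
    by (simp add: norm_mult power_mult_distrib mult.assoc)
  then show ?thesis by (simp add: fps_norm_def real_sqrt_mult)
qed

lemma fps_norm_sum_le:
  "(\<And>i. i \<in> I \<Longrightarrow> dirichlet_fps (F i)) \<Longrightarrow> fps_norm (\<Sum>i\<in>I. F i) \<le> (\<Sum>i\<in>I. fps_norm (F i))"
proof (induction I rule: infinite_finite_induct)
  case (insert x A)
  then have "fps_norm (F x + sum F A) \<le> fps_norm (F x) + fps_norm (sum F A)"
    by (intro fps_norm_triangle dirichlet_fps_sum) auto
  with insert show ?case by fastforce
qed (simp_all add: fps_norm_def)

text \<open>The l1 norm of the coefficients measures the size of q independently of any series. It
  is the norm that the triangle inequality over the monomials of q produces directly; coefficients
  beyond d are ignored, so it is used together with a degree bound.\<close>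

definition coeff_norm :: "nat \<Rightarrow> complex poly \<Rightarrow> real" where
  "coeff_norm d q = (\<Sum>j\<le>d. cmod (coeff q j))"

lemma coeff_norm_nonneg: "coeff_norm d q \<ge> 0"
  by (simp add: coeff_norm_def sum_nonneg)

lemma fps_norm_X_power_le_degree:
  assumes "dirichlet_fps F" "j \<le> d"
  shows "fps_norm (fps_X ^ j * F) \<le> shift_const ^ d * fps_norm F"
proof -
  have "shift_const ^ j \<le> shift_const ^ d"
    using assms(2) shift_const_ge_1 by (rule power_increasing)
  then show ?thesis
    using fps_norm_X_power_le[OF assms(1), of j] fps_norm_nonneg[OF assms(1)]
    by (meson mult_right_mono order_trans)
qed

lemma fps_norm_poly_mult_le:
  assumes "dirichlet_fps F" "degree q \<le> d"
  shows "fps_norm (fps_of_poly q * F) \<le> shift_const ^ d * coeff_norm d q * fps_norm F"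
proof -
  have "fps_norm (fps_of_poly q * F) \<le> (\<Sum>j\<le>d. fps_norm (fps_const (coeff q j) * (fps_X ^ j * F)))"
    unfolding fps_of_poly_mult_eq_sum[OF assms(2)]
    by (intro fps_norm_sum_le dirichlet_fps_scale dirichlet_fps_X_power assms)
  also have "\<dots> \<le> (\<Sum>j\<le>d. cmod (coeff q j) * (shift_const ^ d * fps_norm F))"
  proof (rule sum_mono)
    fix j assume "j \<in> {..d}"
    then show "fps_norm (fps_const (coeff q j) * (fps_X ^ j * F))
        \<le> cmod (coeff q j) * (shift_const ^ d * fps_norm F)"
      by (simp add: fps_norm_scale dirichlet_fps_X_power fps_norm_X_power_le_degree assms
          mult_left_mono)
  qed
  also have "\<dots> = shift_const ^ d * coeff_norm d q * fps_norm F"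
    by (simp add: coeff_norm_def sum_distrib_right sum_distrib_left mult_ac)
  finally show ?thesis .
qed

lemma fps_norm_triangle_diff:
  assumes "dirichlet_fps F" "dirichlet_fps G"
  shows "fps_norm (F - G) \<le> fps_norm F + fps_norm G"
proof -
  have eq: "F - G = F + fps_const (-1) * G" by (simp add: fps_eq_iff)
  show ?thesis
    unfolding eq using fps_norm_triangle[OF assms(1) dirichlet_fps_scale[OF assms(2), of "-1"]]
      fps_norm_scale[OF assms(2), of "-1"] by simp
qed

section \<open>Orthogonal projections onto the polynomial multiples of a series\<close>

text \<open>Gram-Schmidt, one shift of F at a time. The subspace is described by coefficients
  vanishing from d on rather than by a degree bound, so that d = 0 is the zero space and starts the
  induction. The target U stays arbitrary because the induction hypothesis is needed for two
  targets.\<close>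

lemma poly_multiple_projection_exists:
  assumes F: "dirichlet_fps F" and U: "dirichlet_fps U"
  shows "\<exists>p. (\<forall>i\<ge>d. coeff p i = 0) \<and>
    (\<forall>q. (\<forall>i\<ge>d. coeff q i = 0) \<longrightarrow>
      fps_inner (fps_of_poly p * F - U) (fps_of_poly q * F) = 0)"
  using U
proof (induction d arbitrary: U)
  case 0
  have "fps_inner V (fps_of_poly q * F) = 0" if "\<forall>i\<ge>0. coeff q i = 0" for q V
  proof -
    have "q = 0" using that by (simp add: poly_eq_iff)
    then show ?thesis by simp
  qed
  then show ?case by (intro exI[of _ 0]) simp
next
  case (Suc d)
  note intros = dirichlet_fps_poly_mult[OF F] dirichlet_fps_diff dirichlet_fps_scale
    dirichlet_fps_X_power[OF F] Suc.prems
  obtain p where p: "\<forall>i\<ge>d. coeff p i = 0"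
    and p_orth: "\<And>q. \<forall>i\<ge>d. coeff q i = 0 \<Longrightarrow>
      fps_inner (fps_of_poly p * F - U) (fps_of_poly q * F) = 0"
    using Suc by blast
  \<comment> \<open>The second target is the new direction \<open>fps_X ^ d * F\<close> itself; the
    residual \<open>E\<close> of its projection is orthogonal to the old subspace and, together with
    it, spans the new one.\<close>
  obtain r where r: "\<forall>i\<ge>d. coeff r i = 0"
    and r_orth: "\<And>q. \<forall>i\<ge>d. coeff q i = 0 \<Longrightarrow>
      fps_inner (fps_of_poly r * F - fps_X ^ d * F) (fps_of_poly q * F) = 0"
    using Suc.IH[OF dirichlet_fps_X_power[OF F, of d]] by blast
  define s where "s = r - monom 1 d"
  define E where "E = fps_of_poly s * F"
  define W where "W = fps_of_poly p * F - U"
  \<comment> \<open>The component of \<open>W\<close> along \<open>E\<close>. If \<open>E\<close> is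
    0, the division by zero gives 0, and \<open>W\<close> needs no correction.\<close>
  define t where "t = fps_inner W E / fps_inner E E"
  have E_eq: "E = fps_of_poly r * F - fps_X ^ d * F"
    by (simp add: E_def s_def fps_of_poly_diff fps_of_poly_monom' left_diff_distrib)
  have dE: "dirichlet_fps E" and dW: "dirichlet_fps W"
    unfolding E_def W_def by (intro intros)+
  have EE: "fps_inner E E = 0 \<Longrightarrow> E = 0"
    using fps_norm_eq_0_imp[OF dE] by (simp add: fps_inner_self[OF dE])
  have WE: "fps_inner (W - fps_const t * E) E = 0"
    using EE by (cases "E = 0")
      (auto simp: t_def fps_inner_diff_left fps_inner_scale_left dE dW dirichlet_fps_scale)
  show ?case
  proof (intro exI[of _ "p - Polynomial.smult t s"] conjI allI impI)
    fix i assume "i \<ge> Suc d"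
    then show "coeff (p - Polynomial.smult t s) i = 0" using p r by (simp add: s_def)
  next
    fix q :: "complex poly" assume q: "\<forall>i\<ge>Suc d. coeff q i = 0"
    \<comment> \<open>The polynomial \<open>s\<close> has coefficient -1 at d, so adding
      \<open>coeff q d\<close> times \<open>s\<close> cancels the top coefficient of
      \<open>q\<close>. Hence \<open>q\<close> times F splits into an old multiple, handled by the
      induction hypothesis, and a multiple of \<open>E\<close>, handled by
      \<open>WE\<close>.\<close>
    define q' where "q' = q + Polynomial.smult (coeff q d) s"
    have q': "\<forall>i\<ge>d. coeff q' i = 0"
    proof (intro allI impI)
      fix i assume "i \<ge> d"
      then show "coeff q' i = 0"
        using q r by (cases "i = d") (auto simp: q'_def s_def)
    qed
    have "fps_of_poly q * F = fps_of_poly q' * F - fps_const (coeff q d) * E"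
      by (simp add: q'_def E_def fps_of_poly_add fps_of_poly_smult algebra_simps)
    moreover have "fps_of_poly (p - Polynomial.smult t s) * F - U = W - fps_const t * E"
      by (simp add: W_def E_def fps_of_poly_diff fps_of_poly_smult algebra_simps)
    moreover have "fps_inner (W - fps_const t * E) (fps_of_poly q' * F) = 0"
      using p_orth[OF q'] r_orth[OF q'] dE dW
      by (simp add: fps_inner_diff_left fps_inner_scale_left dirichlet_fps_scale
          dirichlet_fps_poly_mult[OF F] flip: E_eq W_def)
    ultimately show
      "fps_inner (fps_of_poly (p - Polynomial.smult t s) * F - U) (fps_of_poly q * F) = 0"
      using WE dE dW
      by (simp add: fps_inner_diff_right fps_inner_scale_right dirichlet_fps_scale
          dirichlet_fps_poly_mult[OF F] dirichlet_fps_diff)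
  qed
qed

text \<open>The linear system Mc = b in weak form: taking for q the monomials up to degree d gives
  its rows, and conjugate linearity in q gives the rest.\<close>

definition normal_solution :: "nat \<Rightarrow> complex fps \<Rightarrow> complex poly \<Rightarrow> bool" where
  "normal_solution d F p \<longleftrightarrow> degree p \<le> d \<and>
    (\<forall>q. degree q \<le> d \<longrightarrow> fps_inner (fps_of_poly p * F - 1) (fps_of_poly q * F) = 0)"

lemma normal_solution_exists:
  assumes "dirichlet_fps F"
  shows "\<exists>p. normal_solution d F p"
proof -
  \<comment> \<open>Degree at most d means that the coefficients vanish from d + 1 on, hence the
    instance \<open>Suc d\<close> of the projection lemma.\<close>
  have "degree q \<le> d \<longleftrightarrow> (\<forall>i\<ge>Suc d. coeff q i = 0)" for q :: "complex poly"
    by (auto simp: coeff_eq_0 intro: degree_le)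
  then show ?thesis
    using poly_multiple_projection_exists[OF assms dirichlet_fps_1, of "Suc d"]
    unfolding normal_solution_def by simp
qed

text \<open>The residual of p is orthogonal to (q - p) F, which is the difference of the two
  residuals. Both minimality and uniqueness are read off from this identity.\<close>

lemma normal_solution_Pythagoras:
  assumes F: "dirichlet_fps F" and p: "normal_solution d F p" and q: "degree q \<le> d"
  shows "(fps_norm (fps_of_poly q * F - 1))\<^sup>2 =
    (fps_norm (fps_of_poly p * F - 1))\<^sup>2 + (fps_norm (fps_of_poly (q - p) * F))\<^sup>2"
proof -
  have eq: "fps_of_poly q * F - 1 = (fps_of_poly p * F - 1) + fps_of_poly (q - p) * F"
    by (simp add: fps_of_poly_diff algebra_simps)
  have "degree (q - p) \<le> d"
    using p q by (intro degree_diff_le) (auto simp: normal_solution_def)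
  then have "fps_inner (fps_of_poly p * F - 1) (fps_of_poly (q - p) * F) = 0"
    using p by (simp add: normal_solution_def)
  then show ?thesis
    unfolding eq using F by (simp add: fps_norm_add_power2 dirichlet_fps_diff dirichlet_fps_poly_mult)
qed

lemma normal_solution_imp_minimizer:
  assumes F: "dirichlet_fps F" and p: "normal_solution d F p" and q: "degree q \<le> d"
  shows "fps_norm (fps_of_poly p * F - 1) \<le> fps_norm (fps_of_poly q * F - 1)"
proof (rule power2_le_imp_le)
  show "(fps_norm (fps_of_poly p * F - 1))\<^sup>2 \<le> (fps_norm (fps_of_poly q * F - 1))\<^sup>2"
    using normal_solution_Pythagoras[OF assms] by simp
qed (intro fps_norm_nonneg dirichlet_fps_diff dirichlet_fps_poly_mult dirichlet_fps_1 F)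

text \<open>By the Pythagorean identity (q - p) F has norm 0, hence is the zero series; power series
  have no zero divisors, so q = p.\<close>

lemma normal_solution_unique_minimizer:
  assumes F: "dirichlet_fps F" and "F \<noteq> 0" and p: "normal_solution d F p" and q: "degree q \<le> d"
    and min: "fps_norm (fps_of_poly q * F - 1) \<le> fps_norm (fps_of_poly p * F - 1)"
  shows "q = p"
proof -
  have "(fps_norm (fps_of_poly q * F - 1))\<^sup>2 \<le> (fps_norm (fps_of_poly p * F - 1))\<^sup>2"
    using min by (intro power_mono fps_norm_nonneg dirichlet_fps_diff dirichlet_fps_poly_mult F) auto
  then have "(fps_norm (fps_of_poly (q - p) * F))\<^sup>2 \<le> 0"
    using normal_solution_Pythagoras[OF F p q] by linarith
  then have "fps_of_poly (q - p) * F = 0"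
    by (intro fps_norm_eq_0_imp dirichlet_fps_poly_mult F) simp
  with \<open>F \<noteq> 0\<close> have "fps_of_poly (q - p) = fps_of_poly 0" by simp
  then show ?thesis by (simp only: fps_of_poly_eq_iff) simp
qed

section \<open>Stability of optimal approximants\<close>

text \<open>
  If m is the order of vanishing of F at 0 then q F / z^m is q times an invertible series, so the
  coefficients of q are fixed linear combinations of finitely many coefficients of q F.
\<close>

lemma coeff_norm_le_fps_norm_mult:
  assumes F: "dirichlet_fps F" and "F \<noteq> 0"
  shows "\<exists>c>0. \<forall>q. degree q \<le> d \<longrightarrow> c * coeff_norm d q \<le> fps_norm (fps_of_poly q * F)"
proof -
  define m where "m = subdegree F"
  define V where "V = inverse (fps_shift m F)"
  define B where
    "B = (\<Sum>j\<le>d. \<Sum>i=0..j. (real (m + i) + 1) powr (- \<alpha> / 2) * cmod (fps_nth V (j - i)))"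
  have "B \<ge> 0" unfolding B_def by (intro sum_nonneg) simp
  have unit: "fps_shift m F * V = 1"
    using \<open>F \<noteq> 0\<close> unfolding V_def m_def by (intro inverse_mult_eq_1') simp
  have bound: "coeff_norm d q \<le> B * fps_norm (fps_of_poly q * F)" for q :: "complex poly"
  proof -
    let ?Q = "fps_of_poly q * F"
    have "fps_shift m ?Q * V = fps_of_poly q"
      using unit by (simp add: fps_shift_mult m_def mult.assoc)
    then have coeff_eq: "coeff q j = (\<Sum>i=0..j. fps_nth ?Q (m + i) * fps_nth V (j - i))" for j
      using fps_mult_nth[of "fps_shift m ?Q" V j] by (simp add: add.commute)
    have "coeff_norm d q \<le> (\<Sum>j\<le>d. \<Sum>i=0..j. cmod (fps_nth ?Q (m + i) * fps_nth V (j - i)))"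
      unfolding coeff_norm_def coeff_eq by (intro sum_mono norm_sum)
    also have "\<dots> \<le> (\<Sum>j\<le>d. \<Sum>i=0..j.
        (real (m + i) + 1) powr (- \<alpha> / 2) * fps_norm ?Q * cmod (fps_nth V (j - i)))"
      unfolding norm_mult
      by (intro sum_mono mult_right_mono fps_nth_le_fps_norm dirichlet_fps_poly_mult F) simp
    also have "\<dots> = B * fps_norm ?Q"
      by (simp add: B_def sum_distrib_right sum_distrib_left mult_ac)
    finally show ?thesis .
  qed
  show ?thesis
  \<comment> \<open>Adding 1 makes the denominator positive from \<open>B \<ge> 0\<close>
    alone.\<close>
  proof (intro exI[of _ "1 / (B + 1)"] conjI allI impI)
    fix q :: "complex poly"
    have "fps_norm (fps_of_poly q * F) \<ge> 0"
      by (intro fps_norm_nonneg dirichlet_fps_poly_mult F)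
    with bound[of q] have "coeff_norm d q \<le> (B + 1) * fps_norm (fps_of_poly q * F)"
      by (simp add: algebra_simps)
    then show "1 / (B + 1) * coeff_norm d q \<le> fps_norm (fps_of_poly q * F)"
      using \<open>B \<ge> 0\<close> by (simp add: field_simps)
  qed (use \<open>B \<ge> 0\<close> in simp)
qed

lemma normal_solution_Lipschitz:
  assumes F: "dirichlet_fps F" and "F \<noteq> 0" and p: "normal_solution d F p"
  shows "\<exists>C \<delta>. C \<ge> 0 \<and> \<delta> > 0 \<and> (\<forall>G r. dirichlet_fps G \<longrightarrow> fps_norm (G - F) < \<delta> \<longrightarrow>
    normal_solution d G r \<longrightarrow> coeff_norm d (r - p) \<le> C * fps_norm (G - F))"
proof -
  obtain c where "c > 0"
    and c: "\<And>q. degree q \<le> d \<Longrightarrow> c * coeff_norm d q \<le> fps_norm (fps_of_poly q * F)"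
    using coeff_norm_le_fps_norm_mult[OF F \<open>F \<noteq> 0\<close>] by blast
  define K where "K = shift_const ^ d"
  have "K \<ge> 1" unfolding K_def using shift_const_ge_1 by (rule one_le_power)
  define L where "L = coeff_norm d p"
  define E where "E = fps_norm (fps_of_poly p * F - 1)"
  \<comment> \<open>Read off from the final estimate: the first summand comes from pairing the
    residual of p with q D, the second from pairing p D with q G. All ingredients depend only on F,
    d, \<alpha> and p.\<close>
  define A where "A = 2 * E * K / c + K * L"
  have "E \<ge> 0" "L \<ge> 0"
    unfolding E_def L_def
    by (intro fps_norm_nonneg coeff_norm_nonneg dirichlet_fps_diff dirichlet_fps_poly_mult
        dirichlet_fps_1 F)+
  then have "A \<ge> 0" using \<open>K \<ge> 1\<close> \<open>c > 0\<close> by (simp add: A_def)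
  have deg_p: "degree p \<le> d" using p by (simp add: normal_solution_def)
  have main: "coeff_norm d (r - p) \<le> 2 / c * A * fps_norm (G - F)"
    if G: "dirichlet_fps G" and small: "fps_norm (G - F) < c / (2 * K)"
      and r: "normal_solution d G r" for G r
  proof -
    define q where "q = r - p"
    define D where "D = G - F"
    define e where "e = fps_norm D"
    define x where "x = fps_norm (fps_of_poly q * G)"
    have D: "dirichlet_fps D" unfolding D_def by (intro dirichlet_fps_diff F G)
    note dir = dirichlet_fps_poly_mult[OF F] dirichlet_fps_poly_mult[OF G]
      dirichlet_fps_poly_mult[OF D] dirichlet_fps_1 dirichlet_fps_diff dirichlet_fps_add
    have "e \<ge> 0" "x \<ge> 0" unfolding e_def x_def by (intro fps_norm_nonneg dir D)+
    have deg_q: "degree q \<le> d"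
      unfolding q_def using r deg_p by (intro degree_diff_le) (auto simp: normal_solution_def)
    have qD: "fps_norm (fps_of_poly q * D) \<le> K * coeff_norm d q * e"
      unfolding K_def e_def by (rule fps_norm_poly_mult_le[OF D deg_q])
    have pD: "fps_norm (fps_of_poly p * D) \<le> K * L * e"
      unfolding K_def e_def L_def by (rule fps_norm_poly_mult_le[OF D deg_p])
    have qF: "fps_of_poly q * F = fps_of_poly q * G - fps_of_poly q * D"
      by (simp add: D_def algebra_simps)
    \<comment> \<open>The lower bound is available for multiples of F only. Passing to G costs the
      norm of q D, and the radius \<open>c / (2 * K)\<close> is chosen so that this cost is at most
      half of the lower bound and can be absorbed.\<close>
    have q_le: "coeff_norm d q \<le> 2 / c * x"
    proof -
      have "c * coeff_norm d q \<le> x + K * coeff_norm d q * e"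
        using c[OF deg_q] fps_norm_triangle_diff[of "fps_of_poly q * G" "fps_of_poly q * D"] qD
        unfolding qF x_def by (simp add: dir)
      moreover have "K * e \<le> c / 2"
        using small \<open>K \<ge> 1\<close> by (simp add: e_def D_def field_simps)
      then have "(K * e) * coeff_norm d q \<le> c / 2 * coeff_norm d q"
        by (rule mult_right_mono) (rule coeff_norm_nonneg)
      ultimately have "c / 2 * coeff_norm d q \<le> x" by (simp add: mult_ac)
      then show ?thesis using \<open>c > 0\<close> by (simp add: field_simps)
    qed
    \<comment> \<open>The residual of r splits as q G + (p F - 1) + p D and is orthogonal to q G. In
      the middle term q G may be replaced by q D, since p F - 1 is orthogonal to q F.\<close>
    have "fps_inner (fps_of_poly q * G) (fps_of_poly q * G)
        = - fps_inner (fps_of_poly p * F - 1) (fps_of_poly q * D)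
          - fps_inner (fps_of_poly p * D) (fps_of_poly q * G)"
    proof -
      have "fps_inner (fps_of_poly r * G - 1) (fps_of_poly q * G) = 0"
        using r deg_q by (simp add: normal_solution_def)
      moreover have "fps_of_poly r * G - 1
          = fps_of_poly q * G + (fps_of_poly p * F - 1) + fps_of_poly p * D"
        by (simp add: q_def D_def fps_of_poly_diff algebra_simps)
      moreover have "fps_inner (fps_of_poly p * F - 1) (fps_of_poly q * F) = 0"
        using p deg_q by (simp add: normal_solution_def)
      then have "fps_inner (fps_of_poly p * F - 1) (fps_of_poly q * G)
          = fps_inner (fps_of_poly p * F - 1) (fps_of_poly q * D)"
        unfolding qF by (simp add: fps_inner_diff_right dir)
      ultimately have "fps_inner (fps_of_poly q * G) (fps_of_poly q * G)
          + fps_inner (fps_of_poly p * F - 1) (fps_of_poly q * D)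
          + fps_inner (fps_of_poly p * D) (fps_of_poly q * G) = 0"
        by (simp add: fps_inner_add_left dir)
      then show ?thesis by (simp add: add_eq_0_iff)
    qed
    then have "x\<^sup>2 = cmod (- fps_inner (fps_of_poly p * F - 1) (fps_of_poly q * D)
          - fps_inner (fps_of_poly p * D) (fps_of_poly q * G))"
      using fps_inner_self[OF dir(2), of q] by (metis norm_of_real abs_power2 x_def)
    also have "\<dots> \<le> cmod (fps_inner (fps_of_poly p * F - 1) (fps_of_poly q * D))
          + cmod (fps_inner (fps_of_poly p * D) (fps_of_poly q * G))"
      by (rule order_trans[OF norm_triangle_ineq4]) simp
    also have "\<dots> \<le> E * fps_norm (fps_of_poly q * D) + fps_norm (fps_of_poly p * D) * x"
      unfolding E_def x_def by (intro add_mono fps_inner_Cauchy_Schwarz dir)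
    \<comment> \<open>Expressing the size of q through \<open>x\<close> makes both summands linear
      in \<open>x\<close>, so that one factor \<open>x\<close> cancels against the square on the
      left.\<close>
    also have "\<dots> \<le> E * (K * (2 / c * x) * e) + K * L * e * x"
    proof (intro add_mono mult_left_mono mult_right_mono pD)
      have "K * coeff_norm d q * e \<le> K * (2 / c * x) * e"
        using q_le \<open>K \<ge> 1\<close> \<open>e \<ge> 0\<close> by (intro mult_right_mono mult_left_mono) auto
      with qD show "fps_norm (fps_of_poly q * D) \<le> K * (2 / c * x) * e" by linarith
    qed (use \<open>E \<ge> 0\<close> \<open>x \<ge> 0\<close> in auto)
    also have "\<dots> = A * e * x" by (simp add: A_def algebra_simps)
    finally have "x * x \<le> A * e * x" by (simp add: power2_eq_square)
    then have "x \<le> A * e"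
      using \<open>x \<ge> 0\<close> \<open>e \<ge> 0\<close> \<open>A \<ge> 0\<close> by (cases "x = 0") auto
    then have "2 / c * x \<le> 2 / c * (A * e)" using \<open>c > 0\<close> by (intro mult_left_mono) auto
    with q_le show ?thesis by (simp add: q_def e_def D_def)
  qed
  show ?thesis
    by (rule exI[of _ "2 / c * A"], rule exI[of _ "c / (2 * K)"])
      (use main \<open>c > 0\<close> \<open>A \<ge> 0\<close> \<open>K \<ge> 1\<close> in auto)
qed
section \<open>Functions and their expansions\<close>

abbreviation expansion :: "(complex \<Rightarrow> complex) \<Rightarrow> complex fps" where
  "expansion f \<equiv> fps_expansion f 0"

lemma taylor_coeff_eq_fps_nth: "taylor_coeff f k = fps_nth (expansion f) k"
  by (simp add: taylor_coeff_def fps_expansion_def)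

lemma dirichlet_norm_eq: "dirichlet_norm \<alpha> f = fps_norm (expansion f)"
  by (simp add: dirichlet_norm_def fps_norm_def taylor_coeff_eq_fps_nth)

lemma dirichlet_inner_eq: "dirichlet_inner \<alpha> f g = fps_inner (expansion f) (expansion g)"
  by (simp add: dirichlet_inner_def fps_inner_def taylor_coeff_eq_fps_nth)

lemma dirichlet_nonzero_holomorphic: "f \<in> dirichlet_nonzero \<alpha> \<Longrightarrow> f holomorphic_on ball 0 1"
  by (simp add: dirichlet_nonzero_def dirichlet_space_def)

lemma dirichlet_nonzero_has_expansion:
  assumes "f \<in> dirichlet_nonzero \<alpha>"
  shows "f has_fps_expansion expansion f"
  using dirichlet_nonzero_holomorphic[OF assms] by (intro has_fps_expansion_fps_expansion) auto

text \<open>Nonvanishing passes to the expansion by the identity theorem: if all derivatives at 0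
  were 0, the function would vanish on the whole disc.\<close>

lemma dirichlet_nonzero_imp_fps:
  assumes "f \<in> dirichlet_nonzero \<alpha>"
  shows "dirichlet_fps (expansion f)" and "expansion f \<noteq> 0"
proof -
  show "dirichlet_fps (expansion f)"
    using assms by (simp add: dirichlet_nonzero_def dirichlet_space_def dirichlet_fps_def
        taylor_coeff_eq_fps_nth)
  show "expansion f \<noteq> 0"
  proof
    assume "expansion f = 0"
    then have "(deriv ^^ n) f 0 = 0" for n
      by (simp add: fps_eq_iff fps_expansion_def)
    then have "f z = 0" if "z \<in> ball 0 1" for z
      using holomorphic_fun_eq_0_on_ball[OF dirichlet_nonzero_holomorphic[OF assms] that] by blast
    with assms show False by (auto simp: dirichlet_nonzero_def)
  qed
qed

lemma poly_has_fps_expansion: "poly q has_fps_expansion fps_of_poly q" for q :: "complex poly"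
proof (induction q)
  case (pCons a q)
  have "(\<lambda>z. a + z * poly q z) has_fps_expansion fps_const a + fps_X * fps_of_poly q"
    by (intro fps_expansion_intros pCons)
  then show ?case by (simp add: fps_of_poly_pCons algebra_simps)
qed simp

lemma expansion_poly: "expansion (poly q) = fps_of_poly q"
  by (intro fps_expansion_eqI poly_has_fps_expansion)

lemma expansion_1: "expansion (\<lambda>_. 1) = 1"
  by (intro fps_expansion_eqI has_fps_expansion_1)

lemma expansion_residual:
  assumes "f \<in> dirichlet_nonzero \<alpha>"
  shows "expansion (\<lambda>z. poly q z * f z - 1) = fps_of_poly q * expansion f - 1"
  by (intro fps_expansion_eqI has_fps_expansion_diff has_fps_expansion_mult
      has_fps_expansion_1 poly_has_fps_expansion dirichlet_nonzero_has_expansion assms)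

lemma expansion_diff:
  assumes "f \<in> dirichlet_nonzero \<alpha>" "g \<in> dirichlet_nonzero \<alpha>"
  shows "expansion (\<lambda>z. f z - g z) = expansion f - expansion g"
  by (intro fps_expansion_eqI has_fps_expansion_diff dirichlet_nonzero_has_expansion assms)

lemma expansion_shift:
  assumes "f \<in> dirichlet_nonzero \<alpha>"
  shows "expansion ((shift ^^ k) f) = fps_X ^ k * expansion f"
proof -
  have "(shift ^^ k) f = (\<lambda>z. z ^ k * f z)"
    by (induction k) (auto simp: shift_def mult.assoc)
  moreover have "(\<lambda>z. z ^ k * f z) has_fps_expansion fps_X ^ k * expansion f"
    by (intro has_fps_expansion_mult has_fps_expansion_fps_X_power
        dirichlet_nonzero_has_expansion assms)
  ultimately show ?thesis by (simp add: fps_expansion_eqI)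
qed

text \<open>Existence and uniqueness of the minimizer give the definite description in
  \<open>opa\<close> its meaning; afterwards only the orthogonality relations of the approximant are
  used.\<close>

lemma normal_solution_opa:
  assumes "f \<in> dirichlet_nonzero \<alpha>"
  shows "normal_solution d (expansion f) (opa \<alpha> d f)"
proof -
  note f = dirichlet_nonzero_imp_fps[OF assms]
  obtain p where p: "normal_solution d (expansion f) p"
    using normal_solution_exists[OF f(1)] by blast
  have "opa \<alpha> d f = p"
    unfolding opa_def
  proof (rule the_equality)
    show "is_opa \<alpha> d f p"
      using p normal_solution_imp_minimizer[OF f(1) p]
      by (simp add: is_opa_def dirichlet_norm_eq expansion_residual[OF assms] normal_solution_def)
  next
    fix q assume "is_opa \<alpha> d f q"
    then show "q = p"
      using p normal_solution_unique_minimizer[OF f p]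
      by (simp add: is_opa_def dirichlet_norm_eq expansion_residual[OF assms] normal_solution_def)
  qed
  with p show ?thesis by simp
qed

section \<open>Lipschitz estimates for the linear system\<close>

lemma euclidean_norm_le_sum: "euclidean_norm v \<le> (\<Sum>i<dim_vec v. cmod (vec_index v i))"
  using L2_set_le_sum[of "{..<dim_vec v}" "\<lambda>i. cmod (vec_index v i)"]
  by (simp add: euclidean_norm_def L2_set_def)

lemma frobenius_norm_le_sum:
  "frobenius_norm A \<le> (\<Sum>i<dim_row A. \<Sum>j<dim_col A. cmod (index_mat A (i, j)))"
  using L2_set_le_sum[of "{..<dim_row A} \<times> {..<dim_col A}" "\<lambda>ij. cmod (index_mat A ij)"]
  by (simp add: frobenius_norm_def L2_set_def sum.cartesian_product case_prod_beta)

text \<open>Each entry is conjugate linear in the function, so the estimate is global; the factor d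
  + 1 counts the entries.\<close>

lemma system_rhs_Lipschitz:
  assumes f: "f \<in> dirichlet_nonzero \<alpha>" and g: "g \<in> dirichlet_nonzero \<alpha>"
  shows "euclidean_norm (system_rhs \<alpha> d g - system_rhs \<alpha> d f)
    \<le> real (d + 1) * shift_const ^ d * dirichlet_norm \<alpha> (\<lambda>z. g z - f z)"
proof -
  define F where "F = expansion f"
  define G where "G = expansion g"
  have F: "dirichlet_fps F" and G: "dirichlet_fps G"
    unfolding F_def G_def using f g by (auto intro: dirichlet_nonzero_imp_fps)
  have entry: "cmod (vec_index (system_rhs \<alpha> d g - system_rhs \<alpha> d f) k)
      \<le> shift_const ^ d * fps_norm (G - F)" if "k < d + 1" for k
  proof -
    have "vec_index (system_rhs \<alpha> d g - system_rhs \<alpha> d f) k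
        = fps_inner 1 (fps_X ^ k * (G - F))"
      using that F G
      by (simp add: system_rhs_def dirichlet_inner_eq expansion_1 expansion_shift f g
          right_diff_distrib fps_inner_diff_right dirichlet_fps_X_power flip: F_def G_def)
    also have "cmod \<dots> \<le> fps_norm 1 * fps_norm (fps_X ^ k * (G - F))"
      by (intro fps_inner_Cauchy_Schwarz dirichlet_fps_X_power dirichlet_fps_diff F G
          dirichlet_fps_1)
    also have "\<dots> \<le> shift_const ^ d * fps_norm (G - F)"
      using that F G by (simp add: fps_norm_X_power_le_degree dirichlet_fps_diff)
    finally show ?thesis .
  qed
  have dim: "dim_vec (system_rhs \<alpha> d g - system_rhs \<alpha> d f) = d + 1"
    by (simp add: system_rhs_def)
  have "euclidean_norm (system_rhs \<alpha> d g - system_rhs \<alpha> d f)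
      \<le> (\<Sum>k<d + 1. shift_const ^ d * fps_norm (G - F))"
    using euclidean_norm_le_sum[of "system_rhs \<alpha> d g - system_rhs \<alpha> d f"]
    unfolding dim by (rule order_trans) (intro sum_mono entry; simp)
  then show ?thesis
    by (simp add: dirichlet_norm_eq expansion_diff[OF g f] F_def G_def mult.assoc)
qed

lemma system_mat_Lipschitz:
  assumes f: "f \<in> dirichlet_nonzero \<alpha>" and g: "g \<in> dirichlet_nonzero \<alpha>"
  shows "frobenius_norm (system_mat \<alpha> d g - system_mat \<alpha> d f)
    \<le> (real (d + 1))\<^sup>2 * (shift_const ^ d)\<^sup>2 *
        (dirichlet_norm \<alpha> f + dirichlet_norm \<alpha> g) * dirichlet_norm \<alpha> (\<lambda>z. g z - f z)"
proof -
  define F where "F = expansion f"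
  define G where "G = expansion g"
  define K where "K = shift_const ^ d"
  define B where "B = K\<^sup>2 * (fps_norm F + fps_norm G) * fps_norm (G - F)"
  have F: "dirichlet_fps F" and G: "dirichlet_fps G"
    unfolding F_def G_def using f g by (auto intro: dirichlet_nonzero_imp_fps)
  have prod_le: "cmod (fps_inner (fps_X ^ k * U) (fps_X ^ j * V)) \<le> K * fps_norm U * (K * fps_norm V)"
    if U: "dirichlet_fps U" and V: "dirichlet_fps V" and "k \<le> d" "j \<le> d" for U V j k
  proof -
    have "cmod (fps_inner (fps_X ^ k * U) (fps_X ^ j * V))
        \<le> fps_norm (fps_X ^ k * U) * fps_norm (fps_X ^ j * V)"
      by (intro fps_inner_Cauchy_Schwarz dirichlet_fps_X_power U V)
    also have "\<dots> \<le> K * fps_norm U * (K * fps_norm V)"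
      unfolding K_def using that shift_const_ge_1
      by (intro mult_mono fps_norm_X_power_le_degree mult_nonneg_nonneg fps_norm_nonneg
          dirichlet_fps_X_power) auto
    finally show ?thesis .
  qed
  have entry: "cmod (index_mat (system_mat \<alpha> d g - system_mat \<alpha> d f) (j, k)) \<le> B"
    if j: "j < d + 1" and k: "k < d + 1" for j k
  proof -
    have "index_mat (system_mat \<alpha> d g - system_mat \<alpha> d f) (j, k)
        = fps_inner (fps_X ^ k * G) (fps_X ^ j * G) - fps_inner (fps_X ^ k * F) (fps_X ^ j * F)"
      using j k by (simp add: system_mat_def dirichlet_inner_eq expansion_shift f g F_def G_def)
    \<comment> \<open>Changing one argument at a time puts the difference G - F into each summand;
      the other argument contributes the sum of the two norms in the bound.\<close>
    also have "\<dots> = fps_inner (fps_X ^ k * (G - F)) (fps_X ^ j * G)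
        + fps_inner (fps_X ^ k * F) (fps_X ^ j * (G - F))"
      by (simp add: right_diff_distrib fps_inner_diff_right fps_inner_diff_left
          dirichlet_fps_X_power F G)
    also have "cmod \<dots> \<le> K * fps_norm (G - F) * (K * fps_norm G)
        + K * fps_norm F * (K * fps_norm (G - F))"
      using j k by (intro norm_triangle_mono prod_le dirichlet_fps_diff F G) auto
    also have "\<dots> = B" by (simp add: B_def power2_eq_square algebra_simps)
    finally show ?thesis .
  qed
  have dim: "dim_row (system_mat \<alpha> d g - system_mat \<alpha> d f) = d + 1"
    "dim_col (system_mat \<alpha> d g - system_mat \<alpha> d f) = d + 1"
    by (simp_all add: system_mat_def)
  have "frobenius_norm (system_mat \<alpha> d g - system_mat \<alpha> d f) \<le> (\<Sum>j<d + 1. \<Sum>k<d + 1. B)"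
    using frobenius_norm_le_sum[of "system_mat \<alpha> d g - system_mat \<alpha> d f"]
    unfolding dim by (rule order_trans) (intro sum_mono entry; simp)
  then show ?thesis
    by (simp add: dirichlet_norm_eq expansion_diff[OF g f] F_def G_def B_def K_def
        power2_eq_square mult.assoc)
qed

text \<open>Supplies the lower bound in the final squeeze. The polynomial is viewed as a multiple of
  the constant series 1, which makes its series summable.\<close>

lemma dirichlet_norm_poly_nonneg: "dirichlet_norm \<alpha> (poly q) \<ge> 0"
  using dirichlet_fps_poly_mult[OF dirichlet_fps_1, of q]
  by (simp add: dirichlet_norm_eq expansion_poly fps_norm_nonneg)

lemma dirichlet_norm_poly_le:
  assumes "degree q \<le> d"
  shows "dirichlet_norm \<alpha> (poly q) \<le> shift_const ^ d * coeff_norm d q"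
  using fps_norm_poly_mult_le[OF dirichlet_fps_1 assms]
  by (simp add: dirichlet_norm_eq expansion_poly)

lemma system_and_opa_locally_Lipschitz:
  assumes f: "f \<in> dirichlet_nonzero \<alpha>"
  shows "\<exists>C \<delta>. \<delta> > 0 \<and> (\<forall>g\<in>dirichlet_nonzero \<alpha>. dirichlet_norm \<alpha> (\<lambda>z. g z - f z) < \<delta> \<longrightarrow>
    euclidean_norm (system_rhs \<alpha> d g - system_rhs \<alpha> d f)
      \<le> C * dirichlet_norm \<alpha> (\<lambda>z. g z - f z) \<and>
    frobenius_norm (system_mat \<alpha> d g - system_mat \<alpha> d f)
      \<le> C * dirichlet_norm \<alpha> (\<lambda>z. g z - f z) \<and>
    dirichlet_norm \<alpha> (poly (opa \<alpha> d g - opa \<alpha> d f))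
      \<le> C * dirichlet_norm \<alpha> (\<lambda>z. g z - f z))"
proof -
  define F where "F = expansion f"
  define K where "K = shift_const ^ d"
  have F: "dirichlet_fps F" "F \<noteq> 0"
    unfolding F_def using dirichlet_nonzero_imp_fps[OF f] by auto
  have "K \<ge> 1" unfolding K_def using shift_const_ge_1 by (rule one_le_power)
  obtain C0 \<delta> where "C0 \<ge> 0" "\<delta> > 0" and C0: "\<And>G r. dirichlet_fps G \<Longrightarrow> fps_norm (G - F) < \<delta> \<Longrightarrow>
    normal_solution d G r \<Longrightarrow> coeff_norm d (r - opa \<alpha> d f) \<le> C0 * fps_norm (G - F)"
    using normal_solution_Lipschitz[OF F normal_solution_opa[OF f, folded F_def, of d]] by blast
  define C1 where "C1 = real (d + 1) * K"
  \<comment> \<open>When G is within distance 1 of F, its norm is at most that of F plus 1; this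
    removes G from the matrix estimate and is the reason for the 1 in the radius
    \<open>min 1 \<delta>\<close>.\<close>
  define C2 where "C2 = (real (d + 1))\<^sup>2 * K\<^sup>2 * (2 * fps_norm F + 1)"
  define C3 where "C3 = K * C0"
  have nonneg: "C1 \<ge> 0" "C2 \<ge> 0" "C3 \<ge> 0"
    using \<open>K \<ge> 1\<close> \<open>C0 \<ge> 0\<close> fps_norm_nonneg[OF F(1)] by (auto simp: C1_def C2_def C3_def)
  show ?thesis
  proof (rule exI[of _ "C1 + C2 + C3"], rule exI[of _ "min 1 \<delta>"], intro conjI ballI impI)
    fix g assume g: "g \<in> dirichlet_nonzero \<alpha>"
      and small: "dirichlet_norm \<alpha> (\<lambda>z. g z - f z) < min 1 \<delta>"
    define G where "G = expansion g"
    define e where "e = fps_norm (G - F)"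
    have G: "dirichlet_fps G" unfolding G_def using dirichlet_nonzero_imp_fps[OF g] by auto
    have e_eq: "dirichlet_norm \<alpha> (\<lambda>z. g z - f z) = e"
      by (simp add: dirichlet_norm_eq expansion_diff[OF g f] e_def F_def G_def)
    have "e \<ge> 0" unfolding e_def by (intro fps_norm_nonneg dirichlet_fps_diff F G)
    have "e < 1" "e < \<delta>" using small e_eq by auto
    \<comment> \<open>Enlarges an individual constant to the common one, using that the distance
      \<open>e\<close> is nonnegative.\<close>
    note total = order_trans[OF _ mult_right_mono[OF _ \<open>e \<ge> 0\<close>]]
    show "euclidean_norm (system_rhs \<alpha> d g - system_rhs \<alpha> d f)
        \<le> (C1 + C2 + C3) * dirichlet_norm \<alpha> (\<lambda>z. g z - f z)"
      using system_rhs_Lipschitz[OF f g, of d] unfolding e_eq K_def[symmetric] C1_def[symmetric]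
      by (rule total) (use nonneg in auto)
    have "fps_norm G \<le> fps_norm (G - F) + fps_norm F"
      using fps_norm_triangle[OF dirichlet_fps_diff[OF G F(1)] F(1)] by simp
    then have "fps_norm F + fps_norm G \<le> 2 * fps_norm F + 1"
      using \<open>e < 1\<close> by (simp add: e_def)
    then have "(real (d + 1))\<^sup>2 * K\<^sup>2 * (fps_norm F + fps_norm G) * e \<le> C2 * e"
      unfolding C2_def using \<open>e \<ge> 0\<close> by (intro mult_right_mono mult_left_mono) auto
    moreover have "frobenius_norm (system_mat \<alpha> d g - system_mat \<alpha> d f)
        \<le> (real (d + 1))\<^sup>2 * K\<^sup>2 * (fps_norm F + fps_norm G) * e"
      using system_mat_Lipschitz[OF f g, of d] unfolding e_eq K_def[symmetric]
      by (simp add: dirichlet_norm_eq F_def G_def)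
    ultimately have "frobenius_norm (system_mat \<alpha> d g - system_mat \<alpha> d f) \<le> C2 * e"
      by linarith
    then show "frobenius_norm (system_mat \<alpha> d g - system_mat \<alpha> d f)
        \<le> (C1 + C2 + C3) * dirichlet_norm \<alpha> (\<lambda>z. g z - f z)"
      unfolding e_eq by (rule total) (use nonneg in auto)
    have sol: "normal_solution d G (opa \<alpha> d g)"
      unfolding G_def by (rule normal_solution_opa[OF g])
    have "degree (opa \<alpha> d g - opa \<alpha> d f) \<le> d"
      using sol normal_solution_opa[OF f, of d]
      by (intro degree_diff_le) (auto simp: normal_solution_def)
    then have "dirichlet_norm \<alpha> (poly (opa \<alpha> d g - opa \<alpha> d f))
        \<le> K * coeff_norm d (opa \<alpha> d g - opa \<alpha> d f)"
      unfolding K_def by (rule dirichlet_norm_poly_le)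
    also have "\<dots> \<le> K * (C0 * e)"
      using C0[OF G _ sol] \<open>e < \<delta>\<close> \<open>K \<ge> 1\<close> unfolding e_def by (intro mult_left_mono) auto
    finally have "dirichlet_norm \<alpha> (poly (opa \<alpha> d g - opa \<alpha> d f)) \<le> C3 * e"
      by (simp add: C3_def mult.assoc)
    then show "dirichlet_norm \<alpha> (poly (opa \<alpha> d g - opa \<alpha> d f))
        \<le> (C1 + C2 + C3) * dirichlet_norm \<alpha> (\<lambda>z. g z - f z)"
      unfolding e_eq by (rule total) (use nonneg in auto)
  qed (use \<open>\<delta> > 0\<close> in simp)
qed

end

text \<open>The local estimate is applied at each index. Its constant and radius are obtained before
  the sequence is introduced, and convergence only decides from which index on the terms lie within
  the radius.\<close>

theorem corollary4p2:
  fixes \<alpha> :: real and d :: nat and f :: "complex \<Rightarrow> complex"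
  assumes "f \<in> dirichlet_nonzero \<alpha>"
  shows "\<exists>C::real. \<forall>F :: nat \<Rightarrow> complex \<Rightarrow> complex.
     (\<forall>n\<ge>1. F n \<in> dirichlet_nonzero \<alpha>) \<longrightarrow>
     (\<lambda>n. dirichlet_norm \<alpha> (\<lambda>z. F n z - f z)) \<longlonglongrightarrow> 0 \<longrightarrow>
       (\<lambda>n. euclidean_norm (system_rhs \<alpha> d (F n) - system_rhs \<alpha> d f)) \<longlonglongrightarrow> 0 \<and>
       (\<lambda>n. frobenius_norm (system_mat \<alpha> d (F n) - system_mat \<alpha> d f)) \<longlonglongrightarrow> 0 \<and>
       (\<lambda>n. dirichlet_norm \<alpha> (poly (opa \<alpha> d (F n) - opa \<alpha> d f))) \<longlonglongrightarrow> 0 \<and>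
       (\<forall>\<^sub>F n in sequentially.
          euclidean_norm (system_rhs \<alpha> d (F n) - system_rhs \<alpha> d f)
            \<le> C * dirichlet_norm \<alpha> (\<lambda>z. F n z - f z) \<and>
          frobenius_norm (system_mat \<alpha> d (F n) - system_mat \<alpha> d f)
            \<le> C * dirichlet_norm \<alpha> (\<lambda>z. F n z - f z) \<and>
          dirichlet_norm \<alpha> (poly (opa \<alpha> d (F n) - opa \<alpha> d f))
            \<le> C * dirichlet_norm \<alpha> (\<lambda>z. F n z - f z))"
proof -
  interpret dirichlet_weight \<alpha> .
  let ?e = "\<lambda>g. dirichlet_norm \<alpha> (\<lambda>z. g z - f z)"
  let ?v = "\<lambda>g. euclidean_norm (system_rhs \<alpha> d g - system_rhs \<alpha> d f)"
  let ?m = "\<lambda>g. frobenius_norm (system_mat \<alpha> d g - system_mat \<alpha> d f)"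
  let ?p = "\<lambda>g. dirichlet_norm \<alpha> (poly (opa \<alpha> d g - opa \<alpha> d f))"
  obtain C \<delta> where "\<delta> > 0" and C: "\<And>g. g \<in> dirichlet_nonzero \<alpha> \<Longrightarrow> ?e g < \<delta> \<Longrightarrow>
      ?v g \<le> C * ?e g \<and> ?m g \<le> C * ?e g \<and> ?p g \<le> C * ?e g"
    using system_and_opa_locally_Lipschitz[OF assms, of d] by blast
  show ?thesis
  proof (rule exI[of _ C], intro allI impI)
    fix F :: "nat \<Rightarrow> complex \<Rightarrow> complex"
    assume F: "\<forall>n\<ge>1. F n \<in> dirichlet_nonzero \<alpha>" and lim: "(\<lambda>n. ?e (F n)) \<longlonglongrightarrow> 0"
    have "\<forall>\<^sub>F n in sequentially. ?e (F n) < \<delta>"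
      using order_tendstoD(2)[OF lim \<open>\<delta> > 0\<close>] .
    then have ev: "\<forall>\<^sub>F n in sequentially.
        ?v (F n) \<le> C * ?e (F n) \<and> ?m (F n) \<le> C * ?e (F n) \<and> ?p (F n) \<le> C * ?e (F n)"
      \<comment> \<open>Index 0 must be discarded, since membership in the space is assumed from
        index 1 on.\<close>
      using eventually_ge_at_top[of 1] by eventually_elim (use F C in blast)
    have lim': "(\<lambda>n. C * ?e (F n)) \<longlonglongrightarrow> 0"
      using tendsto_mult_right_zero[OF lim] .
    have squeeze: "u \<longlonglongrightarrow> 0"
      if "\<And>n. u n \<ge> 0" "\<forall>\<^sub>F n in sequentially. u n \<le> C * ?e (F n)" for u :: "nat \<Rightarrow> real"
      by (rule tendsto_sandwich[OF _ that(2) tendsto_const lim']) (simp add: that(1))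
    have "(\<lambda>n. ?v (F n)) \<longlonglongrightarrow> 0"
      by (rule squeeze) (use ev in \<open>auto simp: euclidean_norm_def sum_nonneg elim: eventually_mono\<close>)
    moreover have "(\<lambda>n. ?m (F n)) \<longlonglongrightarrow> 0"
      by (rule squeeze) (use ev in \<open>auto simp: frobenius_norm_def sum_nonneg elim: eventually_mono\<close>)
    moreover have "(\<lambda>n. ?p (F n)) \<longlonglongrightarrow> 0"
      by (rule squeeze) (use ev dirichlet_norm_poly_nonneg in \<open>auto elim: eventually_mono\<close>)
    ultimately show "(\<lambda>n. ?v (F n)) \<longlonglongrightarrow> 0 \<and> (\<lambda>n. ?m (F n)) \<longlonglongrightarrow> 0 \<and>
        (\<lambda>n. ?p (F n)) \<longlonglongrightarrow> 0 \<and>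
        (\<forall>\<^sub>F n in sequentially.
          ?v (F n) \<le> C * ?e (F n) \<and> ?m (F n) \<le> C * ?e (F n) \<and> ?p (F n) \<le> C * ?e (F n))"
      using ev by blast
  qed
qed

end
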